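(* Let $f:\mathbb{R}^n\to\mathbb{R}$ be a convex function with global minimum point $x^*$, and suppose that $f$ has an $L$-continuous gradient for some $L>0$ and is $\mu$-strong convex for some $\mu>0$. Let $\rho>0$ and $0<\alpha<2$. Then the gradient method $$\dot x = -\rho\,\frac{\nabla f(x)}{\|\nabla f(x)\|^{\alpha}}$$ reaches the minimum point $x^*$ in a finite time; that is, for every initial condition $x(0)\in\mathbb{R}^n$ there is a finite time at which the trajectory $x(t)$ reaches $x^*$.
   Context: $\|\cdot\|$ is the Euclidean norm and $\langle\cdot,\cdot\rangle$ the inner product on $\mathbb{R}^n$; $\dot x$ denotes the derivative with respect to time $t$. A function $f$ whose gradient exists is said to have an $L$-continuous gradient ($L>0$) if $\langle \nabla f(\theta_1)-\nabla f(\theta_2),\theta_1-\theta_2\rangle\le L\|\theta_1-\theta_2\|^2$ for all $\theta_1,\theta_2$ in the domain of $f$. A convex function $f$ whose gradient exists is said to be $\mu$-strong convex ($\mu>0$) if $\langle \nabla f(\theta_1)-\nabla f(\theta_2),\theta_1-\theta_2\rangle\ge \mu\|\theta_1-\theta_2\|^2$ for all $\theta_1,\theta_2$ in the domain of $f$. The right-hand side of the dynamics may be undefined where $\nabla f(x)=0$; the trajectory is understood to be continuous and to satisfy the equation until it reaches the minimum point. *)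

theory Defs
  imports "HOL-Analysis.Analysis"
begin

definition has_gradient :: "(real ^ 'n \<Rightarrow> real) \<Rightarrow> bool" where
  "has_gradient f \<longleftrightarrow> (\<forall>x. \<exists>D. GDERIV f x :> D)"

definition grad :: "(real ^ 'n \<Rightarrow> real) \<Rightarrow> real ^ 'n \<Rightarrow> real ^ 'n" where
  "grad f x = (THE D. GDERIV f x :> D)"

(* Sanity check for the definite description: a gradient, when it exists, is unique. *)
lemma grad_eqI:
  assumes "GDERIV f x :> D"
  shows "grad f x = D"
  unfolding grad_def
proof (rule the_equality)
  show "GDERIV f x :> D" by (rule assms)
  fix E assume "GDERIV f x :> E"
  then have "(\<lambda>h. h \<bullet> E) = (\<lambda>h. h \<bullet> D)"
    using assms unfolding gderiv_def by (rule has_derivative_unique)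
  then have "\<forall>h. h \<bullet> E = h \<bullet> D" by meson
  then show "E = D" by (metis vector_eq_rdot inner_commute)
qed

(* A one-sided (inner product) condition, as opposed to a Lipschitz bound on the gradient. *)
definition L_continuous_gradient :: "real \<Rightarrow> (real ^ 'n \<Rightarrow> real) \<Rightarrow> bool" where
  "L_continuous_gradient L f \<longleftrightarrow>
     L > 0 \<and> has_gradient f \<and>
     (\<forall>u v. (grad f u - grad f v) \<bullet> (u - v) \<le> L * (norm (u - v))\<^sup>2)"

definition strong_convex :: "real \<Rightarrow> (real ^ 'n \<Rightarrow> real) \<Rightarrow> bool" where
  "strong_convex \<mu> f \<longleftrightarrow>
     \<mu> > 0 \<and> convex_on UNIV f \<and> has_gradient f \<and>
     (\<forall>u v. (grad f u - grad f v) \<bullet> (u - v) \<ge> \<mu> * (norm (u - v))\<^sup>2)"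

(* A trajectory is a continuous curve on [0, \<infinity>) that solves the equation at every time t such
   that the point p has not been visited during [0, t]. No differential equation is imposed from
   the first visit of p onwards, since the right-hand side is not meaningful where the gradient
   vanishes. At t = 0 the derivative is one-sided. *)
definition gradient_trajectory ::
    "real \<Rightarrow> real \<Rightarrow> (real ^ 'n \<Rightarrow> real) \<Rightarrow> real ^ 'n \<Rightarrow> (real \<Rightarrow> real ^ 'n) \<Rightarrow> bool" where
  "gradient_trajectory \<rho> \<alpha> f p x \<longleftrightarrow>
     continuous_on {0..} x \<and>
     (\<forall>t\<ge>0. (\<forall>s\<in>{0..t}. x s \<noteq> p) \<longrightarrow>
        (x has_vector_derivative
           (- (\<rho> / norm (grad f (x t)) powr \<alpha>)) *\<^sub>R grad f (x t)) (at t within {0..}))"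

end

theory Submission
  imports Defs
begin

text \<open>Strong convexity keeps the negative gradient pointed towards the minimum \<open>p\<close>:
  \<open>grad f x \<bullet> (x - p) \<ge> \<mu> * (norm (x - p))\<^sup>2\<close>. Together with the one-sided upper bound, monotonicity makes the
  gradient \<open>L\<close>-Lipschitz (\<open>monotone_gradient_Lipschitz\<close>), so \<open>norm (grad f x) \<le> L * norm (x - p)\<close>.
  Hence, as long as a trajectory has not reached \<open>p\<close>,
  the derivative of \<open>norm (x - p) powr \<alpha>\<close> is

    \<open>- \<alpha> * \<rho> * norm (x - p) powr (\<alpha> - 2) * (grad f x \<bullet> (x - p)) / norm (grad f x) powr \<alpha> \<le> - \<alpha> * \<mu> * \<rho> / L powr \<alpha>\<close>.

  A nonnegative quantity cannot decrease at a fixed positive rate forever, so every trajectory reaches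
  \<open>p\<close> (\<open>normalized_flow_reaches_zero\<close>).

  That there is a trajectory from every initial point is a separate matter, because the right-hand
  side is singular at \<open>p\<close>. From \<open>p\<close> itself the constant curve serves. The plain gradient flow \<open>y' = - grad f y\<close> is Lipschitz and therefore has a global
  solution (\<open>Lipschitz_ODE_global_solution\<close>); started elsewhere, it converges to \<open>p\<close> exponentially fast but never gets there
  (\<open>negative_flow_distance_bounds\<close>). Run in the time \<open>t = \<integral> norm (grad f y) powr \<alpha> / \<rho>\<close>, which has a
  finite total, it becomes a solution of the normalized equation that arrives at \<open>p\<close>
  (\<open>time_change\<close>, \<open>normalized_flow_exists\<close>).\<close>

section \<open>Gradients with a one-sided quadratic bound\<close>

text \<open>Along the segment from \<open>u\<close> to \<open>v\<close> the hypothesis says that the gap between \<open>f\<close> and the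
  quadratic on the right has a derivative of one sign. The constant \<open>L\<close> may have any sign:
  applied to \<open>-f\<close> with \<open>L = 0\<close>, the lemma turns monotonicity of a gradient into the
  first-order inequality of convex functions.\<close>

lemma first_order_upper_bound:
  fixes f :: "'a::real_inner \<Rightarrow> real"
  assumes gr: "\<And>x. GDERIV f x :> g x"
    and mono: "\<And>u v. (g u - g v) \<bullet> (u - v) \<le> L * (norm (u - v))\<^sup>2"
  shows "f v \<le> f u + g u \<bullet> (v - u) + L / 2 * (norm (v - u))\<^sup>2"
proof -
  define w where "w = v - u"
  define h where "h s = f (u + s *\<^sub>R w) - s * (g u \<bullet> w) - L / 2 * s\<^sup>2 * (norm w)\<^sup>2" for s :: real
  have der: "(h has_real_derivative (g (u + s *\<^sub>R w) \<bullet> w - g u \<bullet> w - L * s * (norm w)\<^sup>2)) (at s)" for s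
  proof -
    have "(f has_derivative (\<lambda>k. k \<bullet> g (u + s *\<^sub>R w))) (at (u + s *\<^sub>R w))"
      using gr by (simp add: gderiv_def)
    moreover have "((\<lambda>s. u + s *\<^sub>R w) has_derivative (\<lambda>k. k *\<^sub>R w)) (at s)"
      by (auto intro!: derivative_eq_intros)
    ultimately have "((\<lambda>s. f (u + s *\<^sub>R w)) has_derivative (\<lambda>k. (k *\<^sub>R w) \<bullet> g (u + s *\<^sub>R w))) (at s)"
      by (rule has_derivative_compose[rotated])
    then have "((\<lambda>s. f (u + s *\<^sub>R w)) has_real_derivative (g (u + s *\<^sub>R w) \<bullet> w)) (at s)"
      by (simp add: has_field_derivative_def inner_commute mult_commute_abs)
    then show ?thesis
      unfolding h_def by (auto intro!: derivative_eq_intros)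
  qed
  have "h 1 \<le> h 0"
  proof (rule DERIV_nonpos_imp_nonincreasing[of 0 1 h])
    fix s :: real assume "0 \<le> s"
    have "g (u + s *\<^sub>R w) \<bullet> w - g u \<bullet> w - L * s * (norm w)\<^sup>2 \<le> 0"
    proof (cases "s = 0")
      case False
      with \<open>0 \<le> s\<close> have "s > 0" by simp
      have "s * ((g (u + s *\<^sub>R w) - g u) \<bullet> w) \<le> s * (s * L * (norm w)\<^sup>2)"
        using mono[of "u + s *\<^sub>R w" u] by (simp add: power_mult_distrib power2_eq_square algebra_simps)
      from this \<open>s > 0\<close> have "(g (u + s *\<^sub>R w) - g u) \<bullet> w \<le> s * L * (norm w)\<^sup>2"
        by (rule mult_left_le_imp_le)
      then show ?thesis
        by (simp add: inner_diff_left algebra_simps)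
    qed simp
    with der show "\<exists>y. (h has_real_derivative y) (at s) \<and> y \<le> 0" by blast
  qed simp
  then show ?thesis by (simp add: h_def w_def)
qed

text \<open>A one-sided bound on the gradient does not control its components orthogonal to \<open>u - v\<close>; with
  monotonicity it does. Subtracting the linear part of \<open>f\<close> at \<open>u\<close> leaves a function \<open>\<phi>\<close> whose minimum
  is at \<open>u\<close>. One gradient step of length \<open>1 / L\<close> from \<open>v\<close> lowers \<open>\<phi>\<close> by at least
  \<open>(norm (g v - g u))\<^sup>2 / (2 * L)\<close>, and it cannot pass below the minimum, whereas the quadratic
  upper bound leaves only \<open>L / 2 * (norm (v - u))\<^sup>2\<close> between \<open>\<phi> u\<close> and \<open>\<phi> v\<close>.\<close>

lemma monotone_gradient_Lipschitz:
  fixes f :: "'a::real_inner \<Rightarrow> real"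
  assumes gr: "\<And>x. GDERIV f x :> g x" and "L > 0"
    and upper: "\<And>u v. (g u - g v) \<bullet> (u - v) \<le> L * (norm (u - v))\<^sup>2"
    and mono: "\<And>u v. 0 \<le> (g u - g v) \<bullet> (u - v)"
  shows "norm (g v - g u) \<le> L * norm (v - u)"
proof -
  define \<phi> where "\<phi> = (\<lambda>z. f z - z \<bullet> g u)"
  have gr\<phi>: "GDERIV \<phi> z :> g z - g u" for z
    unfolding \<phi>_def gderiv_def using gr[of z, unfolded gderiv_def]
    by (auto intro!: derivative_eq_intros simp: inner_diff_right)
  define z where "z = v - (1 / L) *\<^sub>R (g v - g u)"
  \<comment> \<open>monotonicity of the gradient makes \<open>u\<close> a minimum of \<open>\<phi>\<close>\<close>
  have "- \<phi> z \<le> - \<phi> u + (- (g u - g u)) \<bullet> (z - u) + 0 / 2 * (norm (z - u))\<^sup>2"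
  proof (rule first_order_upper_bound[where f = "\<lambda>z. - \<phi> z" and g = "\<lambda>z. - (g z - g u)" and L = 0])
    show "GDERIV (\<lambda>z. - \<phi> z) x :> - (g x - g u)" for x
      by (rule GDERIV_minus[OF gr\<phi>])
    show "(- (g a - g u) - - (g b - g u)) \<bullet> (a - b) \<le> 0 * (norm (a - b))\<^sup>2" for a b
      using mono[of a b] by (simp add: inner_diff_left)
  qed
  then have "\<phi> u \<le> \<phi> z" by simp
  also have "\<dots> \<le> \<phi> v + (g v - g u) \<bullet> (z - v) + L / 2 * (norm (z - v))\<^sup>2"
    by (rule first_order_upper_bound[OF gr\<phi>]) (use upper in \<open>simp add: inner_diff_left\<close>)
  also have "\<dots> = \<phi> v - (norm (g v - g u))\<^sup>2 / (2 * L)"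
  proof -
    have "(g v - g u) \<bullet> (z - v) = - ((norm (g v - g u))\<^sup>2 / L)"
      by (simp add: z_def power2_norm_eq_inner)
    moreover have "(norm (z - v))\<^sup>2 = (norm (g v - g u))\<^sup>2 / L\<^sup>2"
      by (simp add: z_def power_divide)
    ultimately show ?thesis
      using \<open>L > 0\<close> by (simp add: field_simps power2_eq_square)
  qed
  finally have "(norm (g v - g u))\<^sup>2 / (2 * L) \<le> f v - f u - g u \<bullet> (v - u)"
    by (simp add: \<phi>_def inner_diff_right inner_commute)
  also have "\<dots> \<le> L / 2 * (norm (v - u))\<^sup>2"
    using first_order_upper_bound[OF gr upper, of v u] by simp
  finally have "(norm (g v - g u))\<^sup>2 \<le> (L * norm (v - u))\<^sup>2"
    using \<open>L > 0\<close> by (simp add: field_simps power2_eq_square)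
  then show ?thesis
    using \<open>L > 0\<close> by (auto intro: power2_le_imp_le)
qed

section \<open>Global solutions of Lipschitz differential equations\<close>

lemma has_vector_derivative_integral_half_line:
  fixes h :: "real \<Rightarrow> 'a::banach"
  assumes "continuous_on {0..} h" and "0 \<le> t"
  shows "((\<lambda>u. integral {0..u} h) has_vector_derivative h t) (at t within {0..})"
proof -
  have "((\<lambda>u. integral {0..u} h) has_vector_derivative h t) (at t within {0..t + 1})"
    using assms by (intro integral_has_vector_derivative) (auto intro: continuous_on_subset)
  moreover have "at t within {0..t + 1} = at t within {0..}"
    by (rule at_within_nhd[of _ "{..<t + 1}"]) auto
  ultimately show ?thesis by simp
qed

lemma integral_exp_Icc:
  fixes k :: real
  assumes "k \<noteq> 0" and "0 \<le> m"
  shows "((\<lambda>s. exp (k * s)) has_integral (exp (k * m) - 1) / k) {0..m}"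
proof -
  have "((\<lambda>s. exp (k * s)) has_integral exp (k * m) / k - exp (k * 0) / k) {0..m}"
    using assms
    by (intro fundamental_theorem_of_calculus)
       (auto intro!: derivative_eq_intros simp flip: has_real_derivative_iff_has_vector_derivative)
  then show ?thesis by (simp add: diff_divide_distrib)
qed

text \<open>The estimate behind the contraction below: in the norm weighted by \<open>exp (- k * t)\<close>,
  integration from \<open>0\<close> gains the factor \<open>1 / k\<close>.\<close>

lemma weighted_integral_bound:
  fixes h :: "real \<Rightarrow> 'a::banach"
  assumes "continuous_on {0..m} h" and "0 \<le> m" and "k > 0" and "C \<ge> 0"
    and "\<And>s. 0 \<le> s \<Longrightarrow> norm (h s) \<le> C * exp (k * s)"
  shows "norm (exp (- k * m) *\<^sub>R integral {0..m} h) \<le> C / k"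
proof -
  have int: "((\<lambda>s. C * exp (k * s)) has_integral C * ((exp (k * m) - 1) / k)) {0..m}"
    using integral_exp_Icc[of k m] assms by (intro has_integral_mult_right) auto
  have "norm (integral {0..m} h) \<le> integral {0..m} (\<lambda>s. C * exp (k * s))"
    using assms int
    by (intro integral_norm_bound_integral) (auto intro: integrable_continuous_real)
  also have "\<dots> = C * ((exp (k * m) - 1) / k)" using int by (rule integral_unique)
  also have "\<dots> \<le> C / k * exp (k * m)" using assms by (simp add: field_simps)
  finally have "exp (- k * m) * norm (integral {0..m} h) \<le> exp (- k * m) * (C / k * exp (k * m))"
    by (intro mult_left_mono) auto
  then show ?thesis by (simp add: exp_minus field_simps)
qed

text \<open>The theorem of Picard and Lindelof in Bielecki's form. Written for the rescaled curve
  \<open>exp (- k * t) *\<^sub>R y t\<close>, the integral equation becomes a fixed point equation on the bounded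
  continuous functions; its operator has Lipschitz constant \<open>L / k\<close>, so with \<open>k = 2 * L\<close> Banach's
  theorem gives the solution on the whole half line at once, without gluing local solutions.\<close>

lemma Lipschitz_ODE_global_solution:
  fixes g :: "'a::banach \<Rightarrow> 'a"
  assumes "L > 0" and lip: "\<And>u v. norm (g u - g v) \<le> L * norm (u - v)"
  obtains y where "y 0 = y0"
    and "\<And>t. 0 \<le> t \<Longrightarrow> (y has_vector_derivative g (y t)) (at t within {0..})"
proof -
  define k where "k = 2 * L"
  have "k > 0" using \<open>L > 0\<close> by (simp add: k_def)
  have "L-lipschitz_on UNIV g"
    using lip \<open>L > 0\<close> by (auto intro!: lipschitz_onI simp: dist_norm)
  then have contg: "continuous_on UNIV g" by (rule lipschitz_on_continuous_on)
  define h :: "(real \<Rightarrow>\<^sub>C 'a) \<Rightarrow> real \<Rightarrow> 'a"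
    where "h z s = g (exp (k * s) *\<^sub>R apply_bcontfun z s)" for z s
  have conth: "continuous_on A (h z)" for A z
    unfolding h_def by (intro continuous_on_compose2[OF contg] continuous_intros) auto
  \<comment> \<open>\<open>max 0 t\<close> extends the operator to functions on all of \<open>\<real>\<close>, constant for negative times\<close>
  define F where "F z t = exp (- k * max 0 t) *\<^sub>R (y0 + integral {0..max 0 t} (h z))" for z t
  have contI: "continuous_on {0..} (\<lambda>t. y0 + integral {0..t} (h z))" for z
  proof (rule continuous_on_add[OF continuous_on_const])
    show "continuous_on {0..} (\<lambda>t. integral {0..t} (h z))"
      using has_vector_derivative_integral_half_line[OF conth]
      by (auto intro: has_vector_derivative_continuous simp: continuous_on_eq_continuous_within)
  qed
  have F_cont: "F z \<in> bcontfun" for z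
  proof (rule bcontfun_normI)
    show "continuous_on UNIV (F z)"
      unfolding F_def
      by (intro continuous_intros continuous_on_compose2[OF contI, where f = "\<lambda>t. max 0 t"]) auto
    fix t
    have hb: "norm (h z s) \<le> (norm (g 0) + L * norm z) * exp (k * s)" if "0 \<le> s" for s
    proof -
      have "norm (h z s) \<le> norm (g 0) + L * norm (exp (k * s) *\<^sub>R apply_bcontfun z s)"
        using lip[of "exp (k * s) *\<^sub>R apply_bcontfun z s" 0] norm_triangle_sub[of "h z s" "g 0"]
        by (simp add: h_def)
      also have "\<dots> \<le> norm (g 0) * exp (k * s) + L * (exp (k * s) * norm z)"
        using that \<open>k > 0\<close> \<open>L > 0\<close> norm_bounded[of z s]
        by (intro add_mono mult_left_mono) (auto simp: mult_le_cancel_left1)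
      finally show ?thesis by (simp add: algebra_simps)
    qed
    have "norm (F z t) \<le> norm (exp (- k * max 0 t) *\<^sub>R y0)
        + norm (exp (- k * max 0 t) *\<^sub>R integral {0..max 0 t} (h z))"
      unfolding F_def scaleR_add_right by (rule norm_triangle_ineq)
    also have "\<dots> \<le> norm y0 + (norm (g 0) + L * norm z) / k"
      using \<open>k > 0\<close> \<open>L > 0\<close> hb
      by (intro add_mono weighted_integral_bound conth) (auto intro!: mult_left_le_one_le)
    finally show "norm (F z t) \<le> norm y0 + (norm (g 0) + L * norm z) / k" .
  qed
  define \<Phi> where "\<Phi> z = Bcontfun (F z)" for z
  have app: "apply_bcontfun (\<Phi> z) = F z" for z
    unfolding \<Phi>_def using F_cont by (simp add: Bcontfun_inverse)
  have "\<exists>!z. \<Phi> z = z"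
  proof (rule banach_fix_type)
    show "\<forall>z w. dist (\<Phi> z) (\<Phi> w) \<le> 1 / 2 * dist z w"
    proof (intro allI dist_bound)
      fix z w t
      have "norm (h z s - h w s) \<le> (L * dist z w) * exp (k * s)" for s
      proof -
        have "norm (h z s - h w s) \<le> L * (exp (k * s) * dist (apply_bcontfun z s) (apply_bcontfun w s))"
          using lip[of "exp (k * s) *\<^sub>R apply_bcontfun z s" "exp (k * s) *\<^sub>R apply_bcontfun w s"]
          by (simp add: h_def dist_norm flip: scaleR_diff_right)
        also have "\<dots> \<le> L * (exp (k * s) * dist z w)"
          using \<open>L > 0\<close> dist_bounded by (intro mult_left_mono) auto
        finally show ?thesis by (simp add: algebra_simps)
      qed
      then have "norm (exp (- k * max 0 t) *\<^sub>R integral {0..max 0 t} (\<lambda>s. h z s - h w s)) \<le> L * dist z w / k"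
        using \<open>k > 0\<close> \<open>L > 0\<close> conth
        by (intro weighted_integral_bound continuous_intros) auto
      moreover have "F z t - F w t = exp (- k * max 0 t) *\<^sub>R integral {0..max 0 t} (\<lambda>s. h z s - h w s)"
        unfolding F_def
        by (subst integral_diff) (auto simp: algebra_simps intro!: integrable_continuous_real conth)
      ultimately show "dist (apply_bcontfun (\<Phi> z) t) (apply_bcontfun (\<Phi> w) t) \<le> 1 / 2 * dist z w"
        using \<open>L > 0\<close> by (simp add: app dist_norm k_def)
    qed
  qed auto
  then obtain z where "\<Phi> z = z" by blast
  then have z: "apply_bcontfun z t = F z t" for t by (metis app)
  define y where "y t = y0 + integral {0..t} (h z)" for t
  have hz: "h z t = g (y t)" if "0 \<le> t" for t
    using that by (simp add: h_def z F_def y_def exp_minus)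
  show thesis
  proof
    show "y 0 = y0" by (simp add: y_def)
    fix t :: real assume "0 \<le> t"
    then have "(y has_vector_derivative 0 + h z t) (at t within {0..})"
      unfolding y_def
      by (intro has_vector_derivative_add has_vector_derivative_integral_half_line conth) auto
    with hz \<open>0 \<le> t\<close> show "(y has_vector_derivative g (y t)) (at t within {0..})" by simp
  qed
qed

section \<open>Distance of the gradient flow from the minimum\<close>

lemma nonincreasing_half_line:
  fixes U :: "real \<Rightarrow> real"
  assumes der: "\<And>s. 0 \<le> s \<Longrightarrow> \<exists>D. (U has_real_derivative D) (at s within {0..}) \<and> D \<le> 0"
    and "0 \<le> t"
  shows "U t \<le> U 0"
proof (rule DERIV_nonpos_imp_decreasing_open[OF \<open>0 \<le> t\<close>])
  fix s assume "0 < s" "s < t"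
  then have "at s within {0..} = at s"
    by (intro at_within_nhd[of _ "{0<..}"]) auto
  with der[of s] \<open>0 < s\<close> show "\<exists>D. DERIV U s :> D \<and> D \<le> 0" by auto
next
  have "continuous_on {0..} U"
    using der by (fastforce simp: continuous_on_eq_continuous_within intro: DERIV_continuous)
  then show "continuous_on {0..t} U" by (rule continuous_on_subset) auto
qed

lemma differential_inequality_exp:
  fixes W :: "real \<Rightarrow> real"
  assumes der: "\<And>s. 0 \<le> s \<Longrightarrow> \<exists>D. (W has_real_derivative D) (at s within {0..}) \<and> D \<le> k * W s"
    and "0 \<le> t"
  shows "W t \<le> W 0 * exp (k * t)"
proof -
  have "W t * exp (- k * t) \<le> W 0 * exp (- k * 0)"
  proof (rule nonincreasing_half_line[OF _ \<open>0 \<le> t\<close>])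
    fix s :: real assume "0 \<le> s"
    then obtain D where D: "(W has_real_derivative D) (at s within {0..})" "D \<le> k * W s"
      using der by blast
    have "((\<lambda>s. W s * exp (- k * s)) has_real_derivative (D - k * W s) * exp (- k * s)) (at s within {0..})"
      by (auto intro!: derivative_eq_intros D(1) simp: algebra_simps)
    moreover have "(D - k * W s) * exp (- k * s) \<le> 0"
      using D(2) by (intro mult_nonpos_nonneg) auto
    ultimately show "\<exists>D. ((\<lambda>s. W s * exp (- k * s)) has_real_derivative D) (at s within {0..}) \<and> D \<le> 0"
      by blast
  qed
  then show ?thesis by (simp add: exp_minus field_simps)
qed

text \<open>The squared distance \<open>W\<close> satisfies \<open>- 2 * L * W \<le> W' \<le> - 2 * \<mu> * W\<close>. The upper bound yields exponential convergence
  to \<open>p\<close> when \<open>0 < \<mu>\<close>; the lower bound shows that the flow, started elsewhere, never arrives at \<open>p\<close> in finite time,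
  so that \<open>g\<close> stays nonzero along it when \<open>0 < \<mu>\<close>.\<close>

lemma negative_flow_distance_bounds:
  fixes y :: "real \<Rightarrow> 'a::real_inner"
  assumes flow: "\<And>t. 0 \<le> t \<Longrightarrow> (y has_vector_derivative - g (y t)) (at t within {0..})"
    and lower: "\<And>z. \<mu> * (norm (z - p))\<^sup>2 \<le> g z \<bullet> (z - p)"
    and upper: "\<And>z. g z \<bullet> (z - p) \<le> L * (norm (z - p))\<^sup>2"
    and "0 \<le> t"
  shows "norm (y t - p) \<le> norm (y 0 - p) * exp (- \<mu> * t)"
    and "norm (y 0 - p) * exp (- L * t) \<le> norm (y t - p)"
proof -
  define W where "W = (\<lambda>s. (norm (y s - p))\<^sup>2)"
  have der: "(W has_real_derivative - 2 * (g (y s) \<bullet> (y s - p))) (at s within {0..})" if "0 \<le> s" for s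
  proof -
    have "((\<lambda>s. (y s - p) \<bullet> (y s - p)) has_vector_derivative
        (y s - p) \<bullet> - g (y s) + - g (y s) \<bullet> (y s - p)) (at s within {0..})"
      using has_vector_derivative_diff[OF flow[OF that] has_vector_derivative_const[of p]]
      by (intro bounded_bilinear.has_vector_derivative[OF bounded_bilinear_inner]) simp_all
    then show ?thesis
      by (simp add: W_def power2_norm_eq_inner inner_commute has_real_derivative_iff_has_vector_derivative)
  qed
  have square: "(a * exp (r * t))\<^sup>2 = a\<^sup>2 * exp (2 * r * t)" for a r :: real
    by (simp add: power_mult_distrib flip: exp_double)
  have "W t \<le> W 0 * exp (- (2 * \<mu>) * t)"
  proof (rule differential_inequality_exp[OF _ \<open>0 \<le> t\<close>])
    fix s :: real assume "0 \<le> s"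
    with der[OF this] lower[of "y s"]
    show "\<exists>D. (W has_real_derivative D) (at s within {0..}) \<and> D \<le> - (2 * \<mu>) * W s"
      by (intro exI[of _ "- 2 * (g (y s) \<bullet> (y s - p))"]) (simp add: W_def)
  qed
  then have "(norm (y t - p))\<^sup>2 \<le> (norm (y 0 - p) * exp (- \<mu> * t))\<^sup>2"
    unfolding square by (simp add: W_def)
  then show "norm (y t - p) \<le> norm (y 0 - p) * exp (- \<mu> * t)"
    by (rule power2_le_imp_le) simp
  have "- W t \<le> - W 0 * exp (- (2 * L) * t)"
  proof (rule differential_inequality_exp[OF _ \<open>0 \<le> t\<close>])
    fix s :: real assume "0 \<le> s"
    with DERIV_minus[OF der[OF this]] upper[of "y s"]
    show "\<exists>D. ((\<lambda>t. - W t) has_real_derivative D) (at s within {0..}) \<and> D \<le> - (2 * L) * - W s"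
      by (intro exI[of _ "2 * (g (y s) \<bullet> (y s - p))"]) (simp add: W_def)
  qed
  then have "(norm (y 0 - p) * exp (- L * t))\<^sup>2 \<le> (norm (y t - p))\<^sup>2"
    unfolding square by (simp add: W_def)
  then show "norm (y 0 - p) * exp (- L * t) \<le> norm (y t - p)"
    by (rule power2_le_imp_le) simp
qed

section \<open>Change of time\<close>

lemma strict_mono_integral_half_line:
  fixes \<phi> :: "real \<Rightarrow> real"
  assumes cont: "continuous_on {0..} \<phi>" and pos: "\<And>s. 0 \<le> s \<Longrightarrow> 0 < \<phi> s"
  shows "strict_mono_on {0..} (\<lambda>s. integral {0..s} \<phi>)"
proof (rule strict_mono_onI)
  fix a b :: real assume ab: "a \<in> {0..}" "b \<in> {0..}" "a < b"
  show "integral {0..a} \<phi> < integral {0..b} \<phi>"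
  proof (rule DERIV_pos_imp_increasing_open[OF \<open>a < b\<close>])
    fix s assume "a < s"
    with ab have "0 < s" by simp
    then have "at s within {0..} = at s"
      by (intro at_within_nhd[of _ "{0<..}"]) auto
    with has_vector_derivative_integral_half_line[OF cont, of s] pos[of s] \<open>0 < s\<close>
    show "\<exists>D. DERIV (\<lambda>s. integral {0..s} \<phi>) s :> D \<and> 0 < D"
      by (auto simp: has_real_derivative_iff_has_vector_derivative)
  next
    have "continuous_on {0..} (\<lambda>s. integral {0..s} \<phi>)"
      using has_vector_derivative_integral_half_line[OF cont]
      by (auto intro: has_vector_derivative_continuous simp: continuous_on_eq_continuous_within)
    then show "continuous_on {a..b} (\<lambda>s. integral {0..s} \<phi>)"
      using ab by (auto intro: continuous_on_subset)
  qed
qed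

text \<open>A curve \<open>y\<close> that needs infinite time to converge to \<open>p\<close> is run in the new time
  \<open>S s = integral {0..s} \<phi>\<close>, that is, with its velocity divided by \<open>\<phi>\<close>. If the total new time \<open>T\<close> is
  finite, the new curve \<open>y \<circ> \<sigma>\<close>, with \<open>\<sigma>\<close> the inverse of \<open>S\<close>, arrives at \<open>p\<close> at time \<open>T\<close> and extends
  continuously by resting there.\<close>

lemma time_change:
  fixes y v :: "real \<Rightarrow> 'a::real_normed_vector" and \<phi> :: "real \<Rightarrow> real"
  assumes der: "\<And>s. 0 \<le> s \<Longrightarrow> (y has_vector_derivative v s) (at s within {0..})"
    and cont: "continuous_on {0..} \<phi>" and pos: "\<And>s. 0 \<le> s \<Longrightarrow> 0 < \<phi> s"
    and bound: "\<And>s. 0 \<le> s \<Longrightarrow> integral {0..s} \<phi> \<le> B"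
    and lim: "(y \<longlongrightarrow> p) at_top"
  obtains T x \<sigma> where "0 < T" "x 0 = y 0" "continuous_on {0..} x"
    and "\<And>t. T \<le> t \<Longrightarrow> x t = p"
    and "\<And>t. 0 \<le> t \<Longrightarrow> t < T \<Longrightarrow> 0 \<le> \<sigma> t \<and> x t = y (\<sigma> t) \<and>
           (x has_vector_derivative (1 / \<phi> (\<sigma> t)) *\<^sub>R v (\<sigma> t)) (at t within {0..})"
proof -
  define S where "S s = integral {0..s} \<phi>" for s
  have derS: "(S has_vector_derivative \<phi> s) (at s within {0..})" if "0 \<le> s" for s
    unfolding S_def[abs_def] using cont that by (rule has_vector_derivative_integral_half_line)
  have contS: "continuous_on {0..} S"
    using derS by (auto intro: has_vector_derivative_continuous simp: continuous_on_eq_continuous_within)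
  have smono: "strict_mono_on {0..} S"
    unfolding S_def[abs_def] using cont pos by (rule strict_mono_integral_half_line)
  have S_less: "S a < S b \<longleftrightarrow> a < b" if "0 \<le> a" "0 \<le> b" for a b
    using strict_mono_on_less[OF smono] that by simp
  have inj: "inj_on S {0..}" using smono by (rule strict_mono_on_imp_inj_on)
  have S0: "S 0 = 0" by (simp add: S_def)
  define T where "T = (SUP s\<in>{0..}. S s)"
  have bdd: "bdd_above (S ` {0..})" using bound by (auto simp: S_def intro!: bdd_aboveI)
  have S_lt: "S s < T" if "0 \<le> s" for s
  proof -
    have "S s < S (s + 1)" using that by (simp add: S_less)
    also have "\<dots> \<le> T" unfolding T_def using bdd that by (intro cSUP_upper) auto
    finally show ?thesis .
  qed
  have "0 < T" using S_lt[of 0] by (simp add: S0)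
  have image: "S ` {0..} = {0..<T}"
  proof (rule subset_antisym; rule subsetI)
    fix t assume "t \<in> S ` {0..}"
    then obtain s where "0 \<le> s" "t = S s" by auto
    then show "t \<in> {0..<T}" using S_lt[of s] S_less[of s 0] by (force simp: S0 not_less[symmetric])
  next
    fix t assume t: "t \<in> {0..<T}"
    then obtain s where s: "0 \<le> s" "t < S s"
      unfolding T_def using less_cSUP_iff[OF _ bdd] by auto
    have "\<exists>r\<ge>0. r \<le> s \<and> S r = t"
      using s t continuous_on_subset[OF contS, of "{0..s}"] IVT'[of S 0 t s] by (auto simp: S0)
    then show "t \<in> S ` {0..}" by auto
  qed
  obtain \<sigma> where hom: "homeomorphism {0..} {0..<T} S \<sigma>"
    using injective_into_1d_eq_homeomorphism[OF contS] inj image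
    by (metis convex_imp_path_connected convex_real_interval(1))
  have \<sigma>_pos: "0 \<le> \<sigma> t" if "0 \<le> t" "t < T" for t
    using hom that unfolding homeomorphism_def by force
  have S\<sigma>: "S (\<sigma> t) = t" if "0 \<le> t" "t < T" for t
    using hom that unfolding homeomorphism_def by force
  have \<sigma>S: "\<sigma> (S s) = s" if "0 \<le> s" for s
    using hom that unfolding homeomorphism_def by force
  have \<sigma>_image: "\<sigma> ` {0..<T} = {0..}"
    using hom unfolding homeomorphism_def by blast
  have der\<sigma>: "(\<sigma> has_vector_derivative 1 / \<phi> (\<sigma> t)) (at t within {0..<T})" if t: "0 \<le> t" "t < T" for t
  proof -
    have "(\<sigma> has_derivative (\<lambda>h. h / \<phi> (\<sigma> t))) (at (S (\<sigma> t)) within S ` {0..})"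
    proof (rule has_derivative_inverse_within)
      show "(S has_derivative (\<lambda>h. h *\<^sub>R \<phi> (\<sigma> t))) (at (\<sigma> t) within {0..})"
        using derS[OF \<sigma>_pos[OF t]] by (simp add: has_vector_derivative_def)
      show "continuous (at (S (\<sigma> t)) within S ` {0..}) \<sigma>"
        using hom t by (simp add: image S\<sigma> homeomorphism_def continuous_on_eq_continuous_within)
      show "linear (\<lambda>h. h / \<phi> (\<sigma> t))"
        by (intro linearI) (auto simp: add_divide_distrib)
    qed (use \<sigma>_pos[OF t] pos[OF \<sigma>_pos[OF t]] \<sigma>S in auto)
    then show ?thesis
      using t by (simp add: image S\<sigma> has_vector_derivative_def)
  qed
  define x where "x t = (if t < T then y (\<sigma> t) else p)" for t
  have derx: "(x has_vector_derivative (1 / \<phi> (\<sigma> t)) *\<^sub>R v (\<sigma> t)) (at t within {0..})"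
    if t: "0 \<le> t" "t < T" for t
  proof -
    have "((y \<circ> \<sigma>) has_vector_derivative (1 / \<phi> (\<sigma> t)) *\<^sub>R v (\<sigma> t)) (at t within {0..<T})"
      using der[OF \<sigma>_pos[OF t]] der\<sigma>[OF t] by (intro vector_diff_chain_within) (simp_all add: \<sigma>_image)
    then have "(x has_vector_derivative (1 / \<phi> (\<sigma> t)) *\<^sub>R v (\<sigma> t)) (at t within {0..<T})"
      by (rule has_vector_derivative_transform[rotated 2]) (use t in \<open>auto simp: x_def\<close>)
    moreover have "at t within {0..<T} = at t within {0..}"
      by (rule at_within_nhd[of _ "{..<T}"]) (use t in auto)
    ultimately show ?thesis by simp
  qed
  have x_late: "x t = p" if "T \<le> t" for t using that by (simp add: x_def)
  have "continuous (at t within {0..}) x" if "0 \<le> t" for t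
  proof (cases "t < T")
    case True
    then show ?thesis using derx that by (blast intro: has_vector_derivative_continuous)
  next
    case False
    \<comment> \<open>the delicate instant is \<open>t = T\<close>: just before \<open>T\<close> the old time is large, so \<open>y\<close> is close to \<open>p\<close>\<close>
    show ?thesis
      unfolding continuous_within tendsto_iff
    proof safe
      fix e :: real assume "0 < e"
      then obtain s1 where s1: "\<And>s. s1 \<le> s \<Longrightarrow> dist (y s) p < e"
        using lim unfolding tendsto_iff eventually_at_top_linorder by blast
      define s2 where "s2 = max 0 s1"
      have near: "dist (x r) p < e" if "S s2 < r" for r
      proof (cases "r < T")
        case True
        have "0 \<le> r" using that S_less[of 0 s2] S0 by (cases "s2 = 0") (auto simp: s2_def)
        then have "s2 < \<sigma> r"
          using that True S_less[of s2 "\<sigma> r"] by (simp add: S\<sigma> \<sigma>_pos s2_def)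
        then have "dist (y (\<sigma> r)) p < e" by (intro s1) (simp add: s2_def)
        with True show ?thesis by (simp add: x_def)
      qed (use \<open>0 < e\<close> in \<open>simp add: x_def\<close>)
      have "S s2 < t" using S_lt[of s2] False by (simp add: s2_def)
      then have "\<forall>\<^sub>F r in at t within {0..}. r \<in> {S s2<..}"
        unfolding eventually_at_topological by (intro exI[of _ "{S s2<..}"]) auto
      then show "\<forall>\<^sub>F r in at t within {0..}. dist (x r) (x t) < e"
        by eventually_elim (use near False in \<open>simp add: x_late\<close>)
    qed
  qed
  then have "continuous_on {0..} x" by (simp add: continuous_on_eq_continuous_within)
  moreover have "x 0 = y 0" using \<open>0 < T\<close> \<sigma>S[of 0] by (simp add: x_def S0)
  ultimately show thesis
    using that[of T x \<sigma>] \<open>0 < T\<close> x_late derx \<sigma>_pos by (simp add: x_def)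
qed

section \<open>Existence of trajectories and finite arrival time\<close>

text \<open>The power \<open>\<alpha>\<close> of the distance is the quantity to follow along the normalized flow: there
  \<open>a = \<rho> / norm v powr \<alpha>\<close>, and \<open>norm v\<close> is at most a multiple of the distance, so that the bound on
  \<open>D\<close> lies below a negative constant.\<close>

lemma distance_power_derivative:
  fixes x :: "real \<Rightarrow> 'a::real_inner"
  assumes der: "(x has_vector_derivative - (a *\<^sub>R v)) (at t within A)"
    and "x t \<noteq> p" and lower: "\<mu> * (norm (x t - p))\<^sup>2 \<le> v \<bullet> (x t - p)"
    and "0 \<le> a" and "0 < \<alpha>"
  shows "\<exists>D. ((\<lambda>s. norm (x s - p) powr \<alpha>) has_real_derivative D) (at t within A) \<and>
             D \<le> - (\<alpha> * \<mu> * a) * norm (x t - p) powr \<alpha>"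
proof -
  define d where "d = norm (x t - p)"
  have "0 < d" using \<open>x t \<noteq> p\<close> by (simp add: d_def)
  have "((\<lambda>s. x s - p) has_derivative (\<lambda>h. h *\<^sub>R - (a *\<^sub>R v))) (at t within A)"
    using has_vector_derivative_diff[OF der has_vector_derivative_const[of p]]
    by (simp add: has_vector_derivative_def)
  from has_derivative_compose[OF this has_derivative_norm[of "x t - p"]] \<open>x t \<noteq> p\<close>
  have "((\<lambda>s. norm (x s - p)) has_derivative (\<lambda>h. (h *\<^sub>R - (a *\<^sub>R v)) \<bullet> sgn (x t - p))) (at t within A)"
    by simp
  moreover have "(\<lambda>h. (h *\<^sub>R - (a *\<^sub>R v)) \<bullet> sgn (x t - p)) = (*) (- (a * (v \<bullet> (x t - p)) / d))"
    by (simp add: fun_eq_iff sgn_div_norm d_def divide_inverse mult_ac)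
  ultimately have "((\<lambda>s. norm (x s - p)) has_real_derivative - (a * (v \<bullet> (x t - p)) / d)) (at t within A)"
    by (simp add: has_field_derivative_def)
  moreover have "((\<lambda>r. r powr \<alpha>) has_real_derivative \<alpha> * d powr (\<alpha> - 1)) (at (norm (x t - p)))"
    using has_real_derivative_powr[OF \<open>0 < d\<close>] by (simp add: d_def)
  ultimately have "((\<lambda>s. norm (x s - p) powr \<alpha>) has_real_derivative
      \<alpha> * d powr (\<alpha> - 1) * - (a * (v \<bullet> (x t - p)) / d)) (at t within A)"
    by (rule DERIV_chain')
  moreover have "\<alpha> * d powr (\<alpha> - 1) * - (a * (v \<bullet> (x t - p)) / d) \<le> - (\<alpha> * \<mu> * a) * d powr \<alpha>"
  proof -
    have "\<mu> * d \<le> v \<bullet> (x t - p) / d"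
      using lower \<open>0 < d\<close> by (simp add: d_def field_simps power2_eq_square)
    then have "\<alpha> * d powr (\<alpha> - 1) * (a * (\<mu> * d)) \<le> \<alpha> * d powr (\<alpha> - 1) * (a * (v \<bullet> (x t - p) / d))"
      using \<open>0 \<le> a\<close> \<open>0 < \<alpha>\<close> by (intro mult_left_mono) auto
    moreover have "d powr (\<alpha> - 1) * d = d powr \<alpha>"
      using \<open>0 < d\<close> by (simp add: powr_diff)
    ultimately show ?thesis by (simp add: algebra_simps)
  qed
  ultimately show ?thesis unfolding d_def by blast
qed

text \<open>The right-hand side of the normalized equation need not be Lipschitz (or even bounded)
  near \<open>p\<close>, but its orbits are those of \<open>y' = - g y\<close>. Changing time with speed
  \<open>\<phi> = norm (g y) powr \<alpha> / \<rho>\<close> produces the required normalization. Since \<open>norm (g y)\<close> is at most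
  \<open>L\<close> times the exponentially decaying distance to \<open>p\<close>, the total new time is finite.\<close>

lemma normalized_flow_exists:
  fixes g :: "'a::euclidean_space \<Rightarrow> 'a"
  assumes "0 < \<mu>" "0 < L" "0 < \<rho>" "0 < \<alpha>"
    and lip: "\<And>u v. norm (g u - g v) \<le> L * norm (u - v)"
    and lower: "\<And>z. \<mu> * (norm (z - p))\<^sup>2 \<le> g z \<bullet> (z - p)"
    and zero: "g p = 0" and "x0 \<noteq> p"
  obtains T x where "0 < T" "x 0 = x0" "continuous_on {0..} x"
    and "\<And>t. T \<le> t \<Longrightarrow> x t = p"
    and "\<And>t. 0 \<le> t \<Longrightarrow> t < T \<Longrightarrow>
          (x has_vector_derivative - (\<rho> / norm (g (x t)) powr \<alpha>) *\<^sub>R g (x t)) (at t within {0..})"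
proof -
  have lip0: "norm (g z) \<le> L * norm (z - p)" for z
    using lip[of z p] zero by simp
  have lip': "norm (- g u - - g v) \<le> L * norm (u - v)" for u v
    using lip[of v u] by (simp add: norm_minus_commute)
  obtain y where y0: "y 0 = x0"
    and flow: "\<And>s. 0 \<le> s \<Longrightarrow> (y has_vector_derivative - g (y s)) (at s within {0..})"
    using Lipschitz_ODE_global_solution[OF \<open>0 < L\<close> lip', of x0] by metis
  have upper: "g z \<bullet> (z - p) \<le> L * (norm (z - p))\<^sup>2" for z
  proof -
    have "g z \<bullet> (z - p) \<le> norm (g z) * norm (z - p)" by (rule norm_cauchy_schwarz)
    also have "\<dots> \<le> L * norm (z - p) * norm (z - p)" by (intro mult_right_mono lip0) simp
    finally show ?thesis by (simp add: power2_eq_square)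
  qed
  define d0 where "d0 = norm (x0 - p)"
  have "0 < d0" using \<open>x0 \<noteq> p\<close> by (simp add: d0_def)
  have decay: "norm (y s - p) \<le> d0 * exp (- \<mu> * s)" if "0 \<le> s" for s
    using negative_flow_distance_bounds(1)[OF flow lower upper that] by (simp add: y0 d0_def)
  have ne: "y s \<noteq> p" if "0 \<le> s" for s
  proof -
    have "0 < d0 * exp (- L * s)" using \<open>0 < d0\<close> by simp
    also have "\<dots> \<le> norm (y s - p)"
      using negative_flow_distance_bounds(2)[OF flow lower upper that] by (simp add: y0 d0_def)
    finally show ?thesis by auto
  qed
  have gne: "g z \<noteq> 0" if "z \<noteq> p" for z
    using lower[of z] that \<open>0 < \<mu>\<close> by (auto simp: mult_le_0_iff)
  define \<phi> where "\<phi> s = norm (g (y s)) powr \<alpha> / \<rho>" for s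
  define C where "C = (L * d0) powr \<alpha> / \<rho>"
  have \<phi>_pos: "0 < \<phi> s" if "0 \<le> s" for s
    using gne[OF ne[OF that]] \<open>0 < \<rho>\<close> by (simp add: \<phi>_def)
  have contg: "continuous_on UNIV g"
    using lip \<open>0 < L\<close> by (intro lipschitz_on_continuous_on[of L] lipschitz_onI) (auto simp: dist_norm)
  have conty: "continuous_on {0..} y"
    using flow by (auto intro: has_vector_derivative_continuous simp: continuous_on_eq_continuous_within)
  have \<phi>_cont: "continuous_on {0..} \<phi>"
    unfolding \<phi>_def using gne ne \<open>0 < \<rho>\<close>
    by (intro continuous_intros continuous_on_compose2[OF contg conty]) auto
  have \<phi>_le: "\<phi> s \<le> C * exp (- (\<alpha> * \<mu>) * s)" if "0 \<le> s" for s
  proof -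
    have "norm (g (y s)) \<le> L * (d0 * exp (- \<mu> * s))"
      using \<open>0 < L\<close> by (intro order_trans[OF lip0] mult_left_mono decay that) simp
    then have "norm (g (y s)) powr \<alpha> \<le> ((L * d0) * exp (- \<mu> * s)) powr \<alpha>"
      using \<open>0 < \<alpha>\<close> by (intro powr_mono2) (simp_all add: mult.assoc)
    also have "\<dots> = (L * d0) powr \<alpha> * exp (- (\<alpha> * \<mu>) * s)"
      using \<open>0 < L\<close> \<open>0 < d0\<close> by (subst powr_mult) (auto simp: powr_def mult_ac)
    finally show ?thesis using \<open>0 < \<rho>\<close> by (simp add: \<phi>_def C_def divide_right_mono)
  qed
  have bound: "integral {0..s} \<phi> \<le> C / (\<alpha> * \<mu>)" if "0 \<le> s" for s
  proof -
    define \<kappa> where "\<kappa> = - (\<alpha> * \<mu>)"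
    have "\<kappa> < 0" using \<open>0 < \<alpha>\<close> \<open>0 < \<mu>\<close> by (simp add: \<kappa>_def)
    have int: "((\<lambda>r. C * exp (\<kappa> * r)) has_integral C * ((exp (\<kappa> * s) - 1) / \<kappa>)) {0..s}"
      using integral_exp_Icc[of \<kappa> s] \<open>\<kappa> < 0\<close> that by (intro has_integral_mult_right) auto
    have "integral {0..s} \<phi> \<le> integral {0..s} (\<lambda>r. C * exp (\<kappa> * r))"
      using \<phi>_le int
      by (intro integral_le integrable_continuous_real continuous_on_subset[OF \<phi>_cont])
         (auto simp: \<kappa>_def intro!: continuous_intros)
    also have "\<dots> = C * ((exp (\<kappa> * s) - 1) / \<kappa>)" using int by (rule integral_unique)
    also have "\<dots> \<le> C * (1 / - \<kappa>)"
      using \<open>\<kappa> < 0\<close> \<open>0 < \<rho>\<close> by (intro mult_left_mono) (auto simp: C_def field_simps mult_le_0_iff)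
    finally show ?thesis by (simp add: \<kappa>_def)
  qed
  have lim: "(y \<longlongrightarrow> p) at_top"
  proof -
    have "((\<lambda>s. d0 * exp (- \<mu> * s)) \<longlongrightarrow> 0) at_top"
      using \<open>0 < \<mu>\<close> by real_asymp
    moreover have "\<forall>\<^sub>F s in at_top. norm (y s - p) \<le> d0 * exp (- \<mu> * s)"
      using eventually_ge_at_top[of 0] by eventually_elim (rule decay)
    ultimately have "((\<lambda>s. y s - p) \<longlongrightarrow> 0) at_top" by (rule Lim_null_comparison[rotated])
    then show ?thesis by (simp add: Lim_null[of y])
  qed
  obtain T x \<sigma> where "0 < T" "x 0 = y 0" "continuous_on {0..} x"
    and late: "\<And>t. T \<le> t \<Longrightarrow> x t = p"
    and early: "\<And>t. 0 \<le> t \<Longrightarrow> t < T \<Longrightarrow> 0 \<le> \<sigma> t \<and> x t = y (\<sigma> t) \<and>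
           (x has_vector_derivative (1 / \<phi> (\<sigma> t)) *\<^sub>R - g (y (\<sigma> t))) (at t within {0..})"
    using time_change[OF flow \<phi>_cont \<phi>_pos bound lim] by metis
  have "(x has_vector_derivative - (\<rho> / norm (g (x t)) powr \<alpha>) *\<^sub>R g (x t)) (at t within {0..})"
    if "0 \<le> t" "t < T" for t
    using early[OF that] by (simp add: \<phi>_def)
  with \<open>0 < T\<close> \<open>x 0 = y 0\<close> \<open>continuous_on {0..} x\<close> late show thesis
    using that[of T x] y0 by simp
qed

text \<open>If \<open>p\<close> were never reached, \<open>U t = norm (x t - p) powr \<alpha>\<close> would decrease at least at the constant
  rate \<open>c\<close> forever, and so become negative.\<close>

lemma normalized_flow_reaches_zero:
  fixes x :: "real \<Rightarrow> 'a::real_inner"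
  assumes "0 < \<mu>" "0 < L" "0 < \<rho>" "0 < \<alpha>"
    and lip: "\<And>z. norm (g z) \<le> L * norm (z - p)"
    and lower: "\<And>z. \<mu> * (norm (z - p))\<^sup>2 \<le> g z \<bullet> (z - p)"
    and der: "\<And>t. 0 \<le> t \<Longrightarrow> (\<And>s. 0 \<le> s \<Longrightarrow> s \<le> t \<Longrightarrow> x s \<noteq> p) \<Longrightarrow>
          (x has_vector_derivative - (\<rho> / norm (g (x t)) powr \<alpha>) *\<^sub>R g (x t)) (at t within {0..})"
  shows "\<exists>T\<ge>0. x T = p"
proof (rule ccontr)
  assume "\<not> (\<exists>T\<ge>0. x T = p)"
  then have ne: "x t \<noteq> p" if "0 \<le> t" for t using that by auto
  define U where "U t = norm (x t - p) powr \<alpha>" for t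
  define c where "c = \<alpha> * \<mu> * \<rho> / L powr \<alpha>"
  have "0 < c" using assms by (simp add: c_def)
  have "U t + c * t \<le> U 0 + c * 0" if "0 \<le> t" for t
  proof (rule nonincreasing_half_line[OF _ that])
    fix s :: real assume "0 \<le> s"
    define a where "a = \<rho> / norm (g (x s)) powr \<alpha>"
    have "0 \<le> a" using \<open>0 < \<rho>\<close> by (simp add: a_def)
    have "(x has_vector_derivative - (a *\<^sub>R g (x s))) (at s within {0..})"
      using der[OF \<open>0 \<le> s\<close>] ne by (simp add: a_def)
    from distance_power_derivative[OF this ne[OF \<open>0 \<le> s\<close>] lower \<open>0 \<le> a\<close> \<open>0 < \<alpha>\<close>]
    obtain D where D: "(U has_real_derivative D) (at s within {0..})" "D \<le> - (\<alpha> * \<mu> * a) * U s"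
      by (auto simp: U_def[abs_def])
    have "c \<le> \<alpha> * \<mu> * a * U s"
    proof -
      have "g (x s) \<noteq> 0"
        using lower[of "x s"] ne[OF \<open>0 \<le> s\<close>] \<open>0 < \<mu>\<close> by (auto simp: mult_le_0_iff)
      moreover have "norm (g (x s)) powr \<alpha> \<le> L powr \<alpha> * U s"
        using powr_mono2[OF _ _ lip[of "x s"], of \<alpha>] \<open>0 < \<alpha>\<close> \<open>0 < L\<close> by (simp add: U_def powr_mult)
      ultimately have "\<rho> / L powr \<alpha> \<le> a * U s"
        using \<open>0 < L\<close> \<open>0 < \<rho>\<close> by (simp add: a_def field_simps)
      then have "\<alpha> * \<mu> * (\<rho> / L powr \<alpha>) \<le> \<alpha> * \<mu> * (a * U s)"
        using \<open>0 < \<alpha>\<close> \<open>0 < \<mu>\<close> by (intro mult_left_mono) auto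
      then show ?thesis by (simp add: c_def mult.assoc)
    qed
    with D(2) have "D + c \<le> 0" by simp
    moreover have "((\<lambda>t. U t + c * t) has_real_derivative D + c) (at s within {0..})"
      by (auto intro!: derivative_eq_intros D(1))
    ultimately show "\<exists>D. ((\<lambda>t. U t + c * t) has_real_derivative D) (at s within {0..}) \<and> D \<le> 0"
      by blast
  qed
  \<comment> \<open>at this time the linear bound on \<open>U\<close> equals \<open>-1\<close>\<close>
  from this[of "(U 0 + 1) / c"] have "U ((U 0 + 1) / c) \<le> - 1"
    using \<open>0 < c\<close> by (simp add: U_def)
  moreover have "0 \<le> U t" for t by (simp add: U_def)
  ultimately show False by (smt (verit))
qed

theorem theorem2:
  fixes f :: "real ^ 'n \<Rightarrow> real" and xstar :: "real ^ 'n" and L \<mu> \<rho> \<alpha> :: real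
  assumes "convex_on UNIV f"
    and "\<forall>y. f xstar \<le> f y"
    and "L > 0" and "L_continuous_gradient L f"
    and "\<mu> > 0" and "strong_convex \<mu> f"
    and "\<rho> > 0" and "0 < \<alpha>" and "\<alpha> < 2"
  shows "\<forall>x0. (\<exists>x. gradient_trajectory \<rho> \<alpha> f xstar x \<and> x 0 = x0) \<and>
              (\<forall>x. gradient_trajectory \<rho> \<alpha> f xstar x \<and> x 0 = x0 \<longrightarrow> (\<exists>T\<ge>0. x T = xstar))"
proof -
  have gr: "GDERIV f z :> grad f z" for z
    using \<open>strong_convex \<mu> f\<close> grad_eqI unfolding strong_convex_def has_gradient_def by metis
  have upper: "(grad f u - grad f v) \<bullet> (u - v) \<le> L * (norm (u - v))\<^sup>2" for u v
    using \<open>L_continuous_gradient L f\<close> by (simp add: L_continuous_gradient_def)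
  have strong: "\<mu> * (norm (u - v))\<^sup>2 \<le> (grad f u - grad f v) \<bullet> (u - v)" for u v
    using \<open>strong_convex \<mu> f\<close> by (simp add: strong_convex_def)
  have mono: "0 \<le> (grad f u - grad f v) \<bullet> (u - v)" for u v
    using strong[of u v] \<open>\<mu> > 0\<close> by (smt (verit) mult_nonneg_nonneg zero_le_power2)
  have lip: "norm (grad f u - grad f v) \<le> L * norm (u - v)" for u v
    using gr \<open>L > 0\<close> upper mono by (rule monotone_gradient_Lipschitz)
  have zero: "grad f xstar = 0"
  proof -
    have "(\<lambda>h. h \<bullet> grad f xstar) = (\<lambda>h. 0)"
      using gr[of xstar] assms(2) unfolding gderiv_def
      by (intro differential_zero_maxmin[of xstar UNIV f]) auto
    then show ?thesis by (metis inner_eq_zero_iff)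
  qed
  have lower: "\<mu> * (norm (z - xstar))\<^sup>2 \<le> grad f z \<bullet> (z - xstar)" for z
    using strong[of z xstar] by (simp add: zero)
  have "\<exists>x. gradient_trajectory \<rho> \<alpha> f xstar x \<and> x 0 = x0" for x0
  proof (cases "x0 = xstar")
    case True
    then have "gradient_trajectory \<rho> \<alpha> f xstar (\<lambda>_. x0)"
      by (auto simp: gradient_trajectory_def)
    then show ?thesis by auto
  next
    case False
    obtain T x where x: "0 < T" "x 0 = x0" "continuous_on {0..} x" "\<And>t. T \<le> t \<Longrightarrow> x t = xstar"
      "\<And>t. 0 \<le> t \<Longrightarrow> t < T \<Longrightarrow>
        (x has_vector_derivative - (\<rho> / norm (grad f (x t)) powr \<alpha>) *\<^sub>R grad f (x t)) (at t within {0..})"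
      using normalized_flow_exists[OF \<open>\<mu> > 0\<close> \<open>L > 0\<close> \<open>\<rho> > 0\<close> \<open>0 < \<alpha>\<close> lip lower zero False]
      by metis
    have "t < T" if "\<forall>s\<in>{0..t}. x s \<noteq> xstar" for t
      using that x(1) x(4)[of T] by (force simp: not_less[symmetric])
    with x show ?thesis by (auto simp: gradient_trajectory_def)
  qed
  moreover have "\<exists>T\<ge>0. x T = xstar" if "gradient_trajectory \<rho> \<alpha> f xstar x" for x
    using that lip[of _ xstar] lower \<open>\<mu> > 0\<close> \<open>L > 0\<close> \<open>\<rho> > 0\<close> \<open>0 < \<alpha>\<close>
    by (intro normalized_flow_reaches_zero[of \<mu> L \<rho> \<alpha> "grad f"]) (auto simp: zero gradient_trajectory_def)
  ultimately show ?thesis by blast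
qed

end
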